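(* If $\widetilde{\varepsilon}<\varepsilon/(1+\varepsilon)$, then the stochastic inexact constraint generation (SiCG) algorithm described in the context terminates in a finite number of iterations almost surely (with respect to the probability measure of selecting a new dual solution $\pi^\star$ in the exploration steps).
   Context: **Problem.** Let $\mathcal{X}\subseteq\mathbb{R}^n$ be nonempty, $\tau\in(0,1)$, $\xi^1,\dots,\xi^N\in\Xi\subseteq\mathbb{R}^\ell$ scenarios with weights $w_i>0$, $\sum_{i=1}^N w_i=1$. For fixed matrices $T,W,C$ and vectors $h$, $q\in\mathbb{R}^m$ of compatible dimensions let $$f(x,\xi)=\min_{y}\{q^\top y\mid Tx+Wy+C\xi\ge h,\ y\ge0\}=\max_{\pi\in\Pi}(h-Tx-C\xi)^\top\pi,\qquad \Pi=\{\pi\mid W^\top\pi\le q,\ \pi\ge 0\}.$$ Standing assumption: for all $x\in\mathcal{X}$, $\xi\in\Xi$ the linear program has an optimal solution and $f(x,\xi)>0$. The quantile minimization problem is $\min_{x\in\mathcal{X}}\widehat{Q}(x)$ with $\widehat{Q}(x)=\inf\{t\in\mathbb{R}\mid\sum_{i=1}^N w_i\mathbf{1}(f(x,\xi^i)\le t)\ge\tau\}$. $M$ is a fixed large enough constant (it suffices that $M\ge f(x,\xi^i)-f(x',\xi^{i'})$ for all $x,x'\in\mathcal{X}$ and all $i,i'$). **SiCG algorithm.** Parameters: tolerance $\varepsilon>0$, $\widetilde{\varepsilon}>0$, a sequence of gaps $\varepsilon_{MP}^j>0$ ($j\ge 0$), $\alpha\in(0,1)$. Initialize $\overline{L}=0$,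 $\overline{U}=\infty$, $\widehat{\Pi}=\emptyset$, $j=1$, $\ell=0$, $L^0=0$. While $(\overline{U}-L^\ell)/\overline{U}>\varepsilon$ (considered true when $\overline{U}=\infty$), perform one iteration: *Step 1 (master problem).* Consider $$v_j^\star=\min_{x\in\mathcal{X},\,t\in\mathbb{R},\,v\in\{0,1\}^N}\ t\quad\text{s.t.}\quad M(1-v_i)\ge\pi^\top(h-Tx-C\xi^i)-t\ \ \forall\pi\in\widehat{\Pi},\ i\in\{1,\dots,N\};\quad \sum_{i=1}^N w_iv_i\ge\tau;\quad t\ge\overline{L}.$$ Solve it to relative gap $\varepsilon_{MP}^j$: obtain a feasible solution $(x^j,t^j,v^j)$, the upper bound $U^j=t^j$ and a lower bound $L^j$ with $\overline{L}\le L^j\le v_j^\star\le U^j$ and $U^j-L^j\le\varepsilon_{MP}^j\,U^j$ (it is assumed that the solver always returns such output). If $L^j>\overline{L}$, set $\ell=j$. Then set $\overline{L}\leftarrow U^j$. *Step 2 (subproblem).* Evaluate $\widehat{Q}(x^j)$ and set $\overline{U}\leftarrow\min\{\overline{U},\widehat{Q}(x^j)\}$. *Step 3 (backtracking).* If $(\overline{U}-U^j)/\overline{U}<\widetilde{\varepsilon}$ (exploitation): set $j=\ell$, $\overline{L}=L^\ell$, and replace $\varepsilon_{MP}^{j'}$ by $\alpha\,\varepsilon_{MP}^{j'}$ for all $j'\ge\ell$ ($\widehat{\Pi}$ is kept). Otherwise (exploration): for each $i\in\{1,\dots,N\}$ compute an optimal solution $\pi_i$ of the dual problem $\max_{\pi\in\Pi}(h-Tx^j-C\xi^i)^\top\pi$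 that is an extreme point of $\Pi$; select $\pi^\star$ at random from $\{\pi_i\mid i\in\{1,\dots,N\},\ \pi_i\notin\widehat{\Pi}\}$, each element having positive probability of being selected; set $\widehat{\Pi}\leftarrow\widehat{\Pi}\cup\{\pi^\star\}$ and $j\leftarrow j+1$. When the while condition fails, the algorithm terminates and returns the solution with the best objective $\overline{U}$. *)

theory Defs
  imports "HOL-Probability.Probability"
begin

(* Vectors are ordered componentwise. The dimensions n, m, l and the number r of rows of the
   linear program are the cardinalities of the index types; scenarios are indexed by {1..N}. *)

record ('n, 'm, 'l, 'r) quantile_problem =
  feasX :: "(real^'n) set"
  Xi :: "(real^'l) set"
  matT :: "real^'n^'r"
  matW :: "real^'m^'r"
  matC :: "real^'l^'r"
  rhs :: "real^'r"
  cost :: "real^'m"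
  scenarios :: nat
  scen :: "nat \<Rightarrow> real^'l"
  weight :: "nat \<Rightarrow> real"
  level :: real
  bigM :: real

definition recourse_feasible ::
  "('n::finite, 'm::finite, 'l::finite, 'r::finite) quantile_problem
    \<Rightarrow> real^'n \<Rightarrow> real^'l \<Rightarrow> real^'m \<Rightarrow> bool" where
  "recourse_feasible P x \<xi> y \<longleftrightarrow>
     matT P *v x + matW P *v y + matC P *v \<xi> \<ge> rhs P \<and> y \<ge> 0"

definition recourse_optimal ::
  "('n::finite, 'm::finite, 'l::finite, 'r::finite) quantile_problem
    \<Rightarrow> real^'n \<Rightarrow> real^'l \<Rightarrow> real^'m \<Rightarrow> bool" where
  "recourse_optimal P x \<xi> y \<longleftrightarrow> recourse_feasible P x \<xi> y \<and>
     (\<forall>y'. recourse_feasible P x \<xi> y' \<longrightarrow> cost P \<bullet> y \<le> cost P \<bullet> y')"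

(* The function f of the problem, as the primal optimal value; the infimum is a minimum
   whenever the linear program has an optimal solution. *)
definition recourse ::
  "('n::finite, 'm::finite, 'l::finite, 'r::finite) quantile_problem
    \<Rightarrow> real^'n \<Rightarrow> real^'l \<Rightarrow> real" where
  "recourse P x \<xi> = Inf {cost P \<bullet> y |y. recourse_feasible P x \<xi> y}"

definition dual_polyhedron ::
  "('n::finite, 'm::finite, 'l::finite, 'r::finite) quantile_problem \<Rightarrow> (real^'r) set" where
  "dual_polyhedron P = {\<pi>. transpose (matW P) *v \<pi> \<le> cost P \<and> \<pi> \<ge> 0}"

definition dual_objective ::
  "('n::finite, 'm::finite, 'l::finite, 'r::finite) quantile_problem
    \<Rightarrow> real^'n \<Rightarrow> real^'l \<Rightarrow> real^'r \<Rightarrow> real" where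
  "dual_objective P x \<xi> \<pi> = (rhs P - matT P *v x - matC P *v \<xi>) \<bullet> \<pi>"

definition dual_extreme_optimal ::
  "('n::finite, 'm::finite, 'l::finite, 'r::finite) quantile_problem
    \<Rightarrow> real^'n \<Rightarrow> real^'l \<Rightarrow> real^'r \<Rightarrow> bool" where
  "dual_extreme_optimal P x \<xi> \<pi> \<longleftrightarrow> \<pi> extreme_point_of dual_polyhedron P \<and>
     (\<forall>\<pi>'\<in>dual_polyhedron P. dual_objective P x \<xi> \<pi>' \<le> dual_objective P x \<xi> \<pi>)"

definition quantile ::
  "('n::finite, 'm::finite, 'l::finite, 'r::finite) quantile_problem \<Rightarrow> real^'n \<Rightarrow> real" where
  "quantile P x = Inf {t. (\<Sum>i = 1..scenarios P.
     weight P i * of_bool (recourse P x (scen P i) \<le> t)) \<ge> level P}"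

record sicg_parameters =
  tol :: real        (* epsilon *)
  tol_back :: real   (* epsilon tilde, the backtracking threshold *)
  gap0 :: "nat \<Rightarrow> real"
  shrink :: real     (* alpha *)

(* Values of the program variables at the head of the while loop.
   idx is j, anchor is the iteration index l of the current valid lower bound,
   Lval j is the most recent L^j and gap j the current gap used at index j. *)
record ('n, 'r) sicg_state =
  idx :: nat
  anchor :: nat
  Lbar :: real
  Ubar :: ereal
  cuts :: "(real^'r) set"
  Lval :: "nat \<Rightarrow> real"
  gap :: "nat \<Rightarrow> real"
  incumbent :: "(real^'n) option"

(* Only L^0 = 0 is prescribed; L^j with j > 0 is written before it is ever read. *)
definition sicg_init :: "sicg_parameters \<Rightarrow> ('n::finite, 'r::finite) sicg_state" where
  "sicg_init A = \<lparr>idx = 1, anchor = 0, Lbar = 0, Ubar = \<infinity>, cuts = {},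
     Lval = (\<lambda>_. 0), gap = gap0 A, incumbent = None\<rparr>"

definition continue_loop ::
  "sicg_parameters \<Rightarrow> ('n::finite, 'r::finite) sicg_state \<Rightarrow> bool" where
  "continue_loop A s \<longleftrightarrow>
     Ubar s = \<infinity> \<or> (Ubar s - ereal (Lval s (anchor s))) / Ubar s > ereal (tol A)"

record 'n master_output =
  xsol :: "real^'n"
  tsol :: real
  vsol :: "nat \<Rightarrow> real"
  lower :: real

definition master_feasible ::
  "('n::finite, 'm::finite, 'l::finite, 'r::finite) quantile_problem \<Rightarrow> ('n, 'r) sicg_state
    \<Rightarrow> real^'n \<Rightarrow> real \<Rightarrow> (nat \<Rightarrow> real) \<Rightarrow> bool" where
  "master_feasible P s x t v \<longleftrightarrow>
     x \<in> feasX P \<and>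
     (\<forall>i\<in>{1..scenarios P}. v i \<in> {0, 1}) \<and>
     (\<forall>\<pi>\<in>cuts s. \<forall>i\<in>{1..scenarios P}.
        bigM P * (1 - v i) \<ge> \<pi> \<bullet> (rhs P - matT P *v x - matC P *v scen P i) - t) \<and>
     (\<Sum>i = 1..scenarios P. weight P i * v i) \<ge> level P \<and>
     t \<ge> Lbar s"

definition master_value ::
  "('n::finite, 'm::finite, 'l::finite, 'r::finite) quantile_problem \<Rightarrow> ('n, 'r) sicg_state
    \<Rightarrow> real" where
  "master_value P s = Inf {t. \<exists>x v. master_feasible P s x t v}"

definition master_solved ::
  "('n::finite, 'm::finite, 'l::finite, 'r::finite) quantile_problem \<Rightarrow> ('n, 'r) sicg_state
    \<Rightarrow> 'n master_output \<Rightarrow> bool" where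
  "master_solved P s out \<longleftrightarrow>
     master_feasible P s (xsol out) (tsol out) (vsol out) \<and>
     Lbar s \<le> lower out \<and> lower out \<le> master_value P s \<and> master_value P s \<le> tsol out \<and>
     tsol out - lower out \<le> gap s (idx s) * tsol out"

(* Effect of Steps 1 and 2, given the solver output; U^j is tsol out. *)
definition update_bounds ::
  "('n::finite, 'm::finite, 'l::finite, 'r::finite) quantile_problem \<Rightarrow> ('n, 'r) sicg_state
    \<Rightarrow> 'n master_output \<Rightarrow> ('n, 'r) sicg_state" where
  "update_bounds P s out = s\<lparr>
     Lval := (Lval s)(idx s := lower out),
     anchor := (if lower out > Lbar s then idx s else anchor s),
     Lbar := tsol out,
     Ubar := min (Ubar s) (ereal (quantile P (xsol out))),
     incumbent := (if ereal (quantile P (xsol out)) < Ubar s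
                   then Some (xsol out) else incumbent s)\<rparr>"

(* Tests of Step 3; s is the state after Steps 1 and 2. *)
definition exploitation ::
  "sicg_parameters \<Rightarrow> ('n::finite, 'r::finite) sicg_state \<Rightarrow> 'n master_output \<Rightarrow> bool" where
  "exploitation A s out \<longleftrightarrow> (Ubar s - ereal (tsol out)) / Ubar s < ereal (tol_back A)"

definition backtrack ::
  "sicg_parameters \<Rightarrow> ('n::finite, 'r::finite) sicg_state \<Rightarrow> ('n, 'r) sicg_state" where
  "backtrack A s = s\<lparr>
     idx := anchor s,
     Lbar := Lval s (anchor s),
     gap := (\<lambda>j'. if j' \<ge> anchor s then shrink A * gap s j' else gap s j')\<rparr>"

definition add_cut ::
  "('n::finite, 'r::finite) sicg_state \<Rightarrow> real^'r \<Rightarrow> ('n, 'r) sicg_state" where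
  "add_cut s \<pi> = s\<lparr>cuts := insert \<pi> (cuts s), idx := Suc (idx s)\<rparr>"

(* A trace is the nonempty list of all states visited so far, most recent first.
   The master solver (solve), the dual solver (duals, indexed by the scenario) and the
   distribution of the random selection (sel) may depend on the whole trace, so that repeated
   calls on the same problem need not return the same answer. *)
definition explores ::
  "('n::finite, 'm::finite, 'l::finite, 'r::finite) quantile_problem \<Rightarrow> sicg_parameters
    \<Rightarrow> (('n, 'r) sicg_state list \<Rightarrow> 'n master_output) \<Rightarrow> ('n, 'r) sicg_state list \<Rightarrow> bool" where
  "explores P A solve tr \<longleftrightarrow> continue_loop A (hd tr) \<and>
     \<not> exploitation A (update_bounds P (hd tr) (solve tr)) (solve tr)"

(* One iteration of the while loop; a state at which the loop has stopped is kept forever. *)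
definition sicg_step ::
  "('n::finite, 'm::finite, 'l::finite, 'r::finite) quantile_problem \<Rightarrow> sicg_parameters
    \<Rightarrow> (('n, 'r) sicg_state list \<Rightarrow> 'n master_output)
    \<Rightarrow> (('n, 'r) sicg_state list \<Rightarrow> (real^'r) pmf)
    \<Rightarrow> ('n, 'r) sicg_state list \<Rightarrow> ('n, 'r) sicg_state pmf" where
  "sicg_step P A solve sel tr =
     (let s = update_bounds P (hd tr) (solve tr) in
      if \<not> continue_loop A (hd tr) then return_pmf (hd tr)
      else if explores P A solve tr then map_pmf (add_cut s) (sel tr)
      else return_pmf (backtrack A s))"

primrec sicg_trace ::
  "('n::finite, 'm::finite, 'l::finite, 'r::finite) quantile_problem \<Rightarrow> sicg_parameters
    \<Rightarrow> (('n, 'r) sicg_state list \<Rightarrow> 'n master_output)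
    \<Rightarrow> (('n, 'r) sicg_state list \<Rightarrow> (real^'r) pmf)
    \<Rightarrow> nat \<Rightarrow> ('n, 'r) sicg_state list pmf" where
  "sicg_trace P A solve sel 0 = return_pmf [sicg_init A]"
| "sicg_trace P A solve sel (Suc k) =
     bind_pmf (sicg_trace P A solve sel k)
       (\<lambda>tr. map_pmf (\<lambda>s. s # tr) (sicg_step P A solve sel tr))"

definition reachable ::
  "('n::finite, 'm::finite, 'l::finite, 'r::finite) quantile_problem \<Rightarrow> sicg_parameters
    \<Rightarrow> (('n, 'r) sicg_state list \<Rightarrow> 'n master_output)
    \<Rightarrow> (('n, 'r) sicg_state list \<Rightarrow> (real^'r) pmf)
    \<Rightarrow> ('n, 'r) sicg_state list set" where
  "reachable P A solve sel = (\<Union>k. set_pmf (sicg_trace P A solve sel k))"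

(* The infinite state process S on the probability space \<Omega> is a random run of the algorithm:
   each initial segment has the law prescribed by the transition probabilities.
   As segments contain the whole past, this fixes all finite-dimensional distributions. *)
definition sicg_process ::
  "('n::finite, 'm::finite, 'l::finite, 'r::finite) quantile_problem \<Rightarrow> sicg_parameters
    \<Rightarrow> (('n, 'r) sicg_state list \<Rightarrow> 'n master_output)
    \<Rightarrow> (('n, 'r) sicg_state list \<Rightarrow> (real^'r) pmf)
    \<Rightarrow> 'w measure \<Rightarrow> (nat \<Rightarrow> 'w \<Rightarrow> ('n, 'r) sicg_state) \<Rightarrow> bool" where
  "sicg_process P A solve sel \<Omega> S \<longleftrightarrow> prob_space \<Omega> \<and>
     (\<forall>k. (\<lambda>\<omega>. map (\<lambda>i. S i \<omega>) (rev [0..<Suc k])) \<in> measurable \<Omega> (count_space UNIV) \<and>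
          distr \<Omega> (count_space UNIV) (\<lambda>\<omega>. map (\<lambda>i. S i \<omega>) (rev [0..<Suc k]))
            = measure_pmf (sicg_trace P A solve sel k))"

end

(* Every exploration adds an extreme point of the dual polyhedron that was not yet a cut, because
   a probability distribution has nonempty support. As there are finitely many extreme points, a run
   that never stops only exploits from some iteration on. Then j and l stay equal and constant, so
   the gap g used in the master problem tends to 0 geometrically. An exploitation step gives
   L >= (1 - g) U and U > (1 - tol_back) Ubar, hence (Ubar - L) / Ubar <= 1 - (1 - g) (1 - tol_back),
   which is at most tol once g <= tol - tol_back: the loop stops after all. *)
theory Submission
  imports Defs
begin

lemma finite_dual_extreme_points:
  fixes P :: "('n::finite, 'm::finite, 'l::finite, 'r::finite) quantile_problem"
  shows "finite {\<pi>. \<pi> extreme_point_of dual_polyhedron P}"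
proof (rule finite_polyhedron_extreme_points)
  \<comment> \<open>Both vector inequalities are componentwise and the index types are finite, so
    only finitely many half-spaces are intersected.\<close>
  have "dual_polyhedron P =
    (\<Inter>j. {\<pi>. transpose (matW P) $ j \<bullet> \<pi> \<le> cost P $ j}) \<inter> (\<Inter>i. {\<pi>. axis i 1 \<bullet> \<pi> \<ge> 0})"
    by (auto simp: dual_polyhedron_def less_eq_vec_def matrix_vector_mul_component inner_axis'
      simp del: transpose_matrix_vector)
  also have "polyhedron \<dots>"
    by (intro polyhedron_Int polyhedron_Inter)
      (auto simp: polyhedron_halfspace_le polyhedron_halfspace_ge)
  finally show "polyhedron (dual_polyhedron P)" .
qed

text \<open>The largest scenario value satisfies the level condition, so the infimum is over a
  nonempty set. Below the smallest value the weighted sum is 0, so that positive value is a lower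
  bound.\<close>

lemma quantile_pos:
  assumes "0 < level P" "level P \<le> 1"
    and sum1: "(\<Sum>i = 1..scenarios P. weight P i) = 1"
    and pos: "\<And>i. i \<in> {1..scenarios P} \<Longrightarrow> 0 < recourse P x (scen P i)"
  shows "0 < quantile P x"
proof -
  define f where "f i = recourse P x (scen P i)" for i
  let ?I = "{1..scenarios P}"
  let ?T = "{t. (\<Sum>i\<in>?I. weight P i * of_bool (f i \<le> t)) \<ge> level P}"
  have ne: "?I \<noteq> {}"
    using sum1 by (metis sum.empty zero_neq_one)
  have "Max (f ` ?I) \<in> ?T"
  proof -
    have "(\<Sum>i\<in>?I. weight P i * of_bool (f i \<le> Max (f ` ?I))) = (\<Sum>i\<in>?I. weight P i)"
      by (intro sum.cong) auto
    then show ?thesis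
      using assms(2) sum1 by (simp only: mem_Collect_eq)
  qed
  moreover have "Min (f ` ?I) \<le> t" if "t \<in> ?T" for t
  proof (rule ccontr)
    assume "\<not> Min (f ` ?I) \<le> t"
    then have "\<not> f i \<le> t" if "i \<in> ?I" for i
      using that by (meson Min_le finite_imageI finite_atLeastAtMost imageI order_trans)
    then have "(\<Sum>i\<in>?I. weight P i * of_bool (f i \<le> t)) = 0"
      by (intro sum.neutral) auto
    with that assms(1) show False by simp
  qed
  ultimately have "Min (f ` ?I) \<le> Inf ?T"
    by (intro cInf_greatest) auto
  moreover have "0 < Min (f ` ?I)"
    using ne pos by (auto simp: f_def)
  ultimately show ?thesis
    by (simp add: quantile_def f_def)
qed

lemma exploitation_stops:
  assumes s: "0 < Ubar s" "idx s = anchor s"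
    and solved: "master_solved P s out"
    and q: "0 < quantile P (xsol out)"
    and g: "gap s (idx s) \<le> 1" "gap s (idx s) \<le> tol A - tol_back A"
    and b: "0 < tol_back A" "tol_back A < 1" "tol_back A < tol A"
    and exploit: "exploitation A (update_bounds P s out) out"
  shows "\<not> continue_loop A (backtrack A (update_bounds P s out))"
proof -
  define L t g b where "L = lower out" and "t = tsol out" and "g = gap s (idx s)"
    and "b = tol_back A"
  \<comment> \<open>\<open>Ubar s\<close> may still be infinite here, but the minimum with a real
    quantile is finite; positivity excludes the value minus infinity.\<close>
  obtain u where u: "min (Ubar s) (ereal (quantile P (xsol out))) = ereal u"
    using s(1) by (cases "Ubar s") (auto simp flip: ereal_min)
  have "0 < ereal u"
    using s(1) q unfolding u[symmetric] by (simp add: min_def)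
  then have u0: "0 < u" by simp
  have "(u - t) / u < b"
    using exploit u u0 by (simp add: exploitation_def update_bounds_def t_def b_def)
  then have t: "(1 - b) * u < t"
    using u0 by (simp add: field_simps)
  have "0 < (1 - b) * u"
    using u0 b by (simp add: b_def)
  with t have t0: "0 < t" by linarith
  have L: "(1 - g) * t \<le> L"
    using solved by (simp add: master_solved_def L_def t_def g_def algebra_simps)
  have "(1 - tol A) * u \<le> L"
  \<comment> \<open>No sign of the gap is assumed. The product estimate needs \<open>g * b\<close>
    to be nonnegative; for negative \<open>g\<close> the factor \<open>1 - g\<close> exceeds 1 and t
    > (1 - b) u is already enough.\<close>
  proof (cases "0 \<le> g")
    case True
    have "(1 - tol A) * u \<le> (1 - g - b + g * b) * u"
      using True g b u0 by (intro mult_right_mono) (auto simp: g_def b_def add_increasing2)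
    also have "\<dots> = (1 - g) * ((1 - b) * u)"
      by (simp add: algebra_simps)
    also have "\<dots> \<le> (1 - g) * t"
      using t g by (intro mult_left_mono) (auto simp: g_def)
    finally show ?thesis using L by simp
  next
    case False
    have "(1 - tol A) * u \<le> (1 - b) * u"
      using b u0 by (intro mult_right_mono) (auto simp: b_def)
    also have "\<dots> \<le> (1 - g) * t"
      using t t0 False by (smt (verit) mult_less_cancel_right2)
    finally show ?thesis using L by simp
  qed
  then have "(u - L) / u \<le> tol A"
    using u0 by (simp add: field_simps)
  \<comment> \<open>As \<open>idx s = anchor s\<close>, both branches of the anchor update give the
    same index, the one at which \<open>lower out\<close> has just been written.\<close>
  moreover have "Lval (backtrack A (update_bounds P s out))
      (anchor (backtrack A (update_bounds P s out))) = L"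
    using s(2) by (simp add: backtrack_def update_bounds_def L_def)
  moreover have "Ubar (backtrack A (update_bounds P s out)) = ereal u"
    using u by (simp add: backtrack_def update_bounds_def)
  ultimately show ?thesis
    using u0 by (simp add: continue_loop_def)
qed

text \<open>This is the pathwise part: chance enters only through the existence of some new point of
  \<open>F\<close> in each exploration. The step hypotheses hold for all \<open>k\<close>, as they
  do on a run assumed never to stop.\<close>

lemma sicg_run_stops:
  fixes s :: "nat \<Rightarrow> ('n::finite, 'r::finite) sicg_state"
    and P :: "('n, 'm::finite, 'l::finite, 'r) quantile_problem"
  assumes F: "finite F"
    and U0: "0 < Ubar (s 0)"
    and b: "0 < tol_back A" "tol_back A < 1" "tol_back A < tol A"
    and shrink: "0 < shrink A" "shrink A < 1"
    and solved: "\<And>k. master_solved P (s k) (out k)"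
    and q: "\<And>k. 0 < quantile P (xsol (out k))"
    and explore: "\<And>k. \<not> exploitation A (update_bounds P (s k) (out k)) (out k) \<Longrightarrow>
      \<exists>\<pi>\<in>F - cuts (s k). s (Suc k) = add_cut (update_bounds P (s k) (out k)) \<pi>"
    and exploit: "\<And>k. exploitation A (update_bounds P (s k) (out k)) (out k) \<Longrightarrow>
      s (Suc k) = backtrack A (update_bounds P (s k) (out k))"
  shows "\<exists>k. \<not> continue_loop A (s k)"
proof -
  let ?ex = "\<lambda>k. exploitation A (update_bounds P (s k) (out k)) (out k)"
  have U: "0 < Ubar (s k)" for k
  proof (induction k)
    case (Suc k)
    have "Ubar (s (Suc k)) = min (Ubar (s k)) (ereal (quantile P (xsol (out k))))"
      using explore[of k] exploit[of k]
      by (cases "?ex k") (auto simp: add_cut_def backtrack_def update_bounds_def)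
    with Suc q[of k] show ?case by (simp add: min_def)
  qed (rule U0)
  \<comment> \<open>This counts the points of \<open>F\<close> still available as cuts: exploration
    lowers it, while exploitation keeps the cuts and hence the count.\<close>
  define missing where "missing k = card (F - cuts (s k))" for k
  have less: "missing (Suc k) < missing k" if "\<not> ?ex k" for k
    using explore[OF that] F
    by (auto simp: missing_def add_cut_def update_bounds_def intro!: psubset_card_mono)
  have "missing (Suc k) = missing k" if "?ex k" for k
    using exploit[OF that] by (simp add: missing_def backtrack_def update_bounds_def)
  with less have "missing (Suc k) \<le> missing k" for k
    by (cases "?ex k") (auto intro: less_imp_le)
  then have "antimono missing"
    by (intro decseq_SucI)
  \<comment> \<open>At a minimiser \<open>K\<close> the decreasing count can drop no further, so
    from \<open>K\<close> on every step exploits.\<close>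
  moreover obtain K where K: "\<And>k. missing K \<le> missing k"
    using ex_has_least_nat[of "\<lambda>_. True" 0 missing] by auto
  ultimately have tail: "?ex k" if "K \<le> k" for k
    using less[of k] K[of "Suc k"] antimonoD[of missing K k] that by fastforce
  \<comment> \<open>The index is read at \<open>Suc K\<close> because the backtracking at
    \<open>K\<close> is what makes \<open>idx\<close> equal to \<open>anchor\<close>. Later updates
    then keep both at \<open>l\<close>, and each backtracking shrinks the gap at \<open>l\<close>
    once.\<close>
  define l where "l = idx (s (Suc K))"
  define g where "g = gap (s (Suc K)) l"
  have inv: "idx (s (Suc K + n)) = l \<and> anchor (s (Suc K + n)) = l \<and>
    gap (s (Suc K + n)) l = shrink A ^ n * g" for n
  proof (induction n)
    case 0
    show ?case
      using exploit[OF tail[of K]] by (auto simp: l_def g_def backtrack_def)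
  next
    case (Suc n)
    have "s (Suc K + Suc n) =
      backtrack A (update_bounds P (s (Suc K + n)) (out (Suc K + n)))"
      using exploit[OF tail[of "Suc K + n"]] by simp
    with Suc show ?case
      by (simp add: backtrack_def update_bounds_def)
  qed
  have "(\<lambda>n. shrink A ^ n * g) \<longlonglongrightarrow> 0"
    using shrink by (intro tendsto_mult_left_zero LIMSEQ_power_zero) simp
  then have "eventually (\<lambda>n. shrink A ^ n * g < min 1 (tol A - tol_back A)) sequentially"
    using b by (intro order_tendstoD) auto
  then obtain n where n: "shrink A ^ n * g < min 1 (tol A - tol_back A)"
    by (auto simp: eventually_sequentially)
  let ?k = "Suc K + n"
  have "\<not> continue_loop A (backtrack A (update_bounds P (s ?k) (out ?k)))"
    using inv[of n] n b U solved q tail[of ?k] by (intro exploitation_stops) auto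
  then show ?thesis
    using exploit[OF tail[of ?k]] by (metis le_add1 le_SucI add_Suc)
qed

text \<open>For each fixed \<open>k\<close> the trace lies almost surely in the support of its law;
  the countable intersection over \<open>k\<close> puts the quantifier inside.\<close>

lemma sicg_process_AE_trace:
  assumes "sicg_process P A solve sel \<Omega> S"
  shows "AE \<omega> in \<Omega>. \<forall>k. map (\<lambda>i. S i \<omega>) (rev [0..<Suc k]) \<in> set_pmf (sicg_trace P A solve sel k)"
proof (subst AE_all_countable, intro allI)
  fix k
  let ?T = "\<lambda>\<omega>. map (\<lambda>i. S i \<omega>) (rev [0..<Suc k])"
  have T: "?T \<in> measurable \<Omega> (count_space UNIV)"
    and d: "distr \<Omega> (count_space UNIV) ?T = measure_pmf (sicg_trace P A solve sel k)"
    using assms by (auto simp: sicg_process_def)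
  have "AE tr in distr \<Omega> (count_space UNIV) ?T. tr \<in> set_pmf (sicg_trace P A solve sel k)"
    unfolding d by (rule AE_measure_pmf)
  then show "AE \<omega> in \<Omega>. ?T \<omega> \<in> set_pmf (sicg_trace P A solve sel k)"
    using T by (subst (asm) AE_distr_iff) auto
qed

theorem theorem6:
  fixes P :: "('n::finite, 'm::finite, 'l::finite, 'r::finite) quantile_problem"
    and A :: sicg_parameters
    and solve :: "('n, 'r) sicg_state list \<Rightarrow> 'n master_output"
    and duals :: "('n, 'r) sicg_state list \<Rightarrow> nat \<Rightarrow> real^'r"
    and sel :: "('n, 'r) sicg_state list \<Rightarrow> (real^'r) pmf"
    and \<Omega> :: "'w measure"
    and S :: "nat \<Rightarrow> 'w \<Rightarrow> ('n, 'r) sicg_state"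
  assumes X_nonempty: "feasX P \<noteq> {}"
    and level: "0 < level P" "level P < 1"
    and scen_in: "\<And>i. i \<in> {1..scenarios P} \<Longrightarrow> scen P i \<in> Xi P"
    and weight_pos: "\<And>i. i \<in> {1..scenarios P} \<Longrightarrow> 0 < weight P i"
    and weight_sum: "(\<Sum>i = 1..scenarios P. weight P i) = 1"
    and lp_solvable: "\<And>x \<xi>. x \<in> feasX P \<Longrightarrow> \<xi> \<in> Xi P \<Longrightarrow> \<exists>y. recourse_optimal P x \<xi> y"
    and recourse_pos: "\<And>x \<xi>. x \<in> feasX P \<Longrightarrow> \<xi> \<in> Xi P \<Longrightarrow> 0 < recourse P x \<xi>"
    and bigM: "\<And>x x' i i'. x \<in> feasX P \<Longrightarrow> x' \<in> feasX P \<Longrightarrow>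
      i \<in> {1..scenarios P} \<Longrightarrow> i' \<in> {1..scenarios P} \<Longrightarrow>
      recourse P x (scen P i) - recourse P x' (scen P i') \<le> bigM P"
    and tol_pos: "0 < tol A"
    and tol_back_pos: "0 < tol_back A"
    and gap0_pos: "\<And>j. 0 < gap0 A j"
    and shrink: "0 < shrink A" "shrink A < 1"
    and solver: "\<And>tr. tr \<in> reachable P A solve sel \<Longrightarrow> continue_loop A (hd tr) \<Longrightarrow>
      master_solved P (hd tr) (solve tr)"
    and dual_solver: "\<And>tr i. tr \<in> reachable P A solve sel \<Longrightarrow> explores P A solve tr \<Longrightarrow>
      i \<in> {1..scenarios P} \<Longrightarrow>
      dual_extreme_optimal P (xsol (solve tr)) (scen P i) (duals tr i)"
    and selection: "\<And>tr. tr \<in> reachable P A solve sel \<Longrightarrow> explores P A solve tr \<Longrightarrow>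
      set_pmf (sel tr) = {duals tr i |i. i \<in> {1..scenarios P} \<and> duals tr i \<notin> cuts (hd tr)}"
    and process: "sicg_process P A solve sel \<Omega> S"
    and tol_back_small: "tol_back A < tol A / (1 + tol A)"
  shows "AE \<omega> in \<Omega>. \<exists>k. \<not> continue_loop A (S k \<omega>)"
proof -
  have quant_pos: "0 < quantile P x" if "x \<in> feasX P" for x
    using level weight_sum scen_in recourse_pos that by (intro quantile_pos) auto
  \<comment> \<open>The first bound keeps \<open>1 - tol_back A\<close> positive, the second leaves
    the positive margin \<open>tol A - tol_back A\<close> for the gap.\<close>
  have "tol A / (1 + tol A) < 1" "tol A / (1 + tol A) < tol A"
    using tol_pos by (auto simp: field_simps)
  with tol_back_small have b: "tol_back A < 1" "tol_back A < tol A"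
    by linarith+
  have stops: "\<exists>k. \<not> continue_loop A (S k \<omega>)"
    if path: "\<forall>k. map (\<lambda>i. S i \<omega>) (rev [0..<Suc k]) \<in> set_pmf (sicg_trace P A solve sel k)"
    for \<omega>
  proof (rule ccontr)
    assume "\<not> ?thesis"
    then have cont: "continue_loop A (S k \<omega>)" for k by blast
    define tr where "tr k = map (\<lambda>i. S i \<omega>) (rev [0..<Suc k])" for k
    have reach: "tr k \<in> reachable P A solve sel" for k
      using path by (auto simp: reachable_def tr_def)
    have hd_tr: "hd (tr k) = S k \<omega>" and tr_Suc: "tr (Suc k) = S (Suc k) \<omega> # tr k" for k
      by (simp_all add: tr_def)
    \<comment> \<open>A trace contains its whole past, so its tail determines the trace from which
      the last step was drawn: it must be \<open>tr k\<close>.\<close>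
    have step: "S (Suc k) \<omega> \<in> set_pmf (sicg_step P A solve sel (tr k))" for k
      using path[rule_format, of "Suc k"] unfolding tr_def[symmetric] tr_Suc
      by (auto simp: set_bind_pmf)
    let ?s = "\<lambda>k. update_bounds P (S k \<omega>) (solve (tr k))"
    have solved: "master_solved P (S k \<omega>) (solve (tr k))" for k
      using solver[OF reach[of k]] cont by (simp add: hd_tr)
    have "\<exists>k. \<not> continue_loop A (S k \<omega>)"
    proof (rule sicg_run_stops[where P = P and out = "\<lambda>k. solve (tr k)"
          and F = "{\<pi>. \<pi> extreme_point_of dual_polyhedron P}"])
      show "0 < Ubar (S 0 \<omega>)"
        using path[rule_format, of 0] by (simp add: sicg_init_def)
      show "0 < quantile P (xsol (solve (tr k)))" for k
        using solved[of k] by (intro quant_pos) (simp add: master_solved_def master_feasible_def)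
      show "\<exists>\<pi>\<in>{\<pi>. \<pi> extreme_point_of dual_polyhedron P} - cuts (S k \<omega>).
          S (Suc k) \<omega> = add_cut (?s k) \<pi>"
        if "\<not> exploitation A (?s k) (solve (tr k))" for k
      proof -
        \<comment> \<open>In an exploration, the drawn point is a dual solution outside the cuts by
          \<open>selection\<close>, and an extreme point by \<open>dual_solver\<close>.\<close>
        have ex: "explores P A solve (tr k)"
          using cont that by (simp add: explores_def hd_tr)
        then obtain \<pi> where "\<pi> \<in> set_pmf (sel (tr k))" "S (Suc k) \<omega> = add_cut (?s k) \<pi>"
          using step[of k] cont by (auto simp: sicg_step_def hd_tr)
        then show ?thesis
          using selection[OF reach ex] dual_solver[OF reach ex]
          by (auto simp: hd_tr dual_extreme_optimal_def)
      qed
      show "S (Suc k) \<omega> = backtrack A (?s k)" if "exploitation A (?s k) (solve (tr k))" for k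
        using step[of k] cont that by (simp add: sicg_step_def explores_def hd_tr)
    qed (use finite_dual_extreme_points tol_back_pos b shrink solved in auto)
    with cont show False by blast
  qed
  show ?thesis
    using sicg_process_AE_trace[OF process] by eventually_elim (rule stops)
qed

end
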